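(* Let $M=(\mathcal{L},r)$ be a matroid or a $q$-matroid, and suppose that its support lattice $\mathcal{L}$ has a proper interval decomposition. Then $M$ has a Tutte partition.
   Context: A matroid or $q$-matroid is a pair $M=(\mathcal{L},r)$, where the support lattice $\mathcal{L}$ is either the Boolean lattice of all subsets of a finite set $S$ with $|S|=n$ (matroid case), or the lattice of all subspaces of an $n$-dimensional vector space over $\mathbb{F}_q$, $q$ a prime power ($q$-matroid case), ordered by inclusion, with meet $\wedge$ and join $\vee$. In the matroid case, formulas involving $q$ are read with $q=1$. The height $\mathrm{h}(x)$ is the cardinality, respectively dimension, of $x$; $\mathbf{0},\mathbf{1}$ are the least and greatest elements of $\mathcal{L}$, so $\mathrm{h}(\mathbf{1})=n$. The function $r:\mathcal{L}\to\mathbb{Z}_{\ge 0}$ satisfies: (R1) $0\le r(x)\le \mathrm{h}(x)$; (R2) $x\le y\Rightarrow r(x)\le r(y)$; (R3) $r(x\vee y)+r(x\wedge y)\le r(x)+r(y)$. Intervals are $[a,b]=\{x: a\le x\le b\}$ for $a\le b$. A diamond is an interval $[a,b]$ with $\mathrm{h}(b)-\mathrm{h}(a)=2$; it is prime if $r(x)-r(a)=1$ and $r(b)-r(x)=0$ for every $x$ with $a<x<b$. An interval is prime-free if it contains no prime diamond $[c,d]$ as a subinterval. A Tutte partition of $M$ is a partition $\mathcal{P}$ of the set $\mathcal{L}$ into intervals such that for every $[a,b]\in\mathcal{P}$: $r(a)=\mathrm{h}(a)$, $r(b)=r(\mathbf{1})$, and $[a,b]$ is prime-free. Atoms are elements of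 height $1$; coatoms are elements of height $n-1$. A complement of $a$ is an element $a^c$ with $a\wedge a^c=\mathbf{0}$, $a\vee a^c=\mathbf{1}$. A proper interval decomposition of $\mathcal{L}$ is a partition of $\mathcal{L}$ into disjoint intervals of the form $$[e,\mathbf{1}]\,\dot\cup\,[\mathbf{0},e^c]\,\dot\cup\,[e_1,\bar e_1]\,\dot\cup\cdots\dot\cup\,[e_{q^{n-1}-1},\bar e_{q^{n-1}-1}],$$ where $e$ is an atom, $e^c$ is a complement of $e$, and for each $k$, $e_k$ is an atom, $\bar e_k$ is a coatom and $e_k\le\bar e_k$. (In the matroid case, $q=1$, it is just $[e,\mathbf{1}]\,\dot\cup\,[\mathbf{0},e^c]$.) *)

theory Defs
  imports Complex_Main "HOL-Library.Disjoint_Sets"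
begin

text \<open>
  A support lattice is given by a family \<open>L\<close> of sets, ordered by inclusion and closed under
  intersections, together with a height function \<open>h\<close>.  The meet is the intersection and the
  join is the smallest member of \<open>L\<close> above both arguments.  The two families in question are
  \<open>Pow S\<close> with \<open>card\<close>, and all subspaces of a vector space with \<open>dim\<close>.
\<close>

definition join :: "'a set set \<Rightarrow> 'a set \<Rightarrow> 'a set \<Rightarrow> 'a set" where
  "join L x y = (\<lambda>z. z \<in> L) hull (x \<union> y)"

definition bottom_elt :: "'a set set \<Rightarrow> 'a set" where
  "bottom_elt L = \<Inter>L"

definition top_elt :: "'a set set \<Rightarrow> 'a set" where
  "top_elt L = \<Union>L"

definition interval :: "'a set set \<Rightarrow> 'a set \<Rightarrow> 'a set \<Rightarrow> 'a set set" where
  "interval L a b = {x \<in> L. a \<subseteq> x \<and> x \<subseteq> b}"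

definition is_atom :: "'a set set \<Rightarrow> ('a set \<Rightarrow> nat) \<Rightarrow> 'a set \<Rightarrow> bool" where
  "is_atom L h x \<longleftrightarrow> x \<in> L \<and> h x = 1"

definition is_coatom :: "'a set set \<Rightarrow> ('a set \<Rightarrow> nat) \<Rightarrow> 'a set \<Rightarrow> bool" where
  "is_coatom L h x \<longleftrightarrow> x \<in> L \<and> h x + 1 = h (top_elt L)"

definition is_complement :: "'a set set \<Rightarrow> 'a set \<Rightarrow> 'a set \<Rightarrow> bool" where
  "is_complement L x y \<longleftrightarrow>
     x \<in> L \<and> y \<in> L \<and> x \<inter> y = bottom_elt L \<and> join L x y = top_elt L"

definition rank_function :: "'a set set \<Rightarrow> ('a set \<Rightarrow> nat) \<Rightarrow> ('a set \<Rightarrow> nat) \<Rightarrow> bool" where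
  "rank_function L h r \<longleftrightarrow>
     (\<forall>x\<in>L. r x \<le> h x) \<and>
     (\<forall>x\<in>L. \<forall>y\<in>L. x \<subseteq> y \<longrightarrow> r x \<le> r y) \<and>
     (\<forall>x\<in>L. \<forall>y\<in>L. r (join L x y) + r (x \<inter> y) \<le> r x + r y)"

definition matroid :: "'a set \<Rightarrow> ('a set \<Rightarrow> nat) \<Rightarrow> bool" where
  "matroid S r \<longleftrightarrow> finite S \<and> rank_function (Pow S) card r"

definition subspaces :: "('f::field \<Rightarrow> 'v::ab_group_add \<Rightarrow> 'v) \<Rightarrow> 'v set set" where
  "subspaces scale = {U. module.subspace scale U}"

text \<open>
  The vector space is the whole type \<open>'v\<close>, with basis \<open>B\<close> serving only to state that it is
  finite-dimensional; the ground field is the finite type \<open>'f\<close>.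
\<close>

definition q_matroid ::
  "('f::{field,finite} \<Rightarrow> 'v::ab_group_add \<Rightarrow> 'v) \<Rightarrow> 'v set \<Rightarrow> ('v set \<Rightarrow> nat) \<Rightarrow> bool" where
  "q_matroid scale B r \<longleftrightarrow>
     finite_dimensional_vector_space scale B \<and>
     rank_function (subspaces scale) (vector_space.dim scale) r"

definition diamond :: "'a set set \<Rightarrow> ('a set \<Rightarrow> nat) \<Rightarrow> 'a set \<Rightarrow> 'a set \<Rightarrow> bool" where
  "diamond L h a b \<longleftrightarrow> a \<in> L \<and> b \<in> L \<and> a \<subseteq> b \<and> h b = h a + 2"

definition prime_diamond ::
  "'a set set \<Rightarrow> ('a set \<Rightarrow> nat) \<Rightarrow> ('a set \<Rightarrow> nat) \<Rightarrow> 'a set \<Rightarrow> 'a set \<Rightarrow> bool" where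
  "prime_diamond L h r a b \<longleftrightarrow>
     diamond L h a b \<and> (\<forall>x\<in>L. a \<subset> x \<and> x \<subset> b \<longrightarrow> r x = r a + 1 \<and> r b = r x)"

definition prime_free ::
  "'a set set \<Rightarrow> ('a set \<Rightarrow> nat) \<Rightarrow> ('a set \<Rightarrow> nat) \<Rightarrow> 'a set \<Rightarrow> 'a set \<Rightarrow> bool" where
  "prime_free L h r a b \<longleftrightarrow> \<not> (\<exists>c d. prime_diamond L h r c d \<and> a \<subseteq> c \<and> d \<subseteq> b)"

definition tutte_partition ::
  "'a set set \<Rightarrow> ('a set \<Rightarrow> nat) \<Rightarrow> ('a set \<Rightarrow> nat) \<Rightarrow> 'a set set set \<Rightarrow> bool" where
  "tutte_partition L h r P \<longleftrightarrow>
     partition_on L P \<and>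
     (\<forall>I\<in>P. \<exists>a\<in>L. \<exists>b\<in>L. a \<subseteq> b \<and> I = interval L a b \<and>
        r a = h a \<and> r b = r (top_elt L) \<and> prime_free L h r a b)"

text \<open>
  \<open>q\<close> is the order of the field, and \<open>1\<close> for a Boolean lattice.  The truncated subtraction in the
  exponent is harmless, since an atom exists only if the height of the lattice is at least \<open>1\<close>.
\<close>

definition has_proper_interval_decomposition ::
  "'a set set \<Rightarrow> ('a set \<Rightarrow> nat) \<Rightarrow> nat \<Rightarrow> bool" where
  "has_proper_interval_decomposition L h q \<longleftrightarrow>
     (\<exists>e e' lo hi. let J = {1..q ^ (h (top_elt L) - 1) - 1};
          A = interval L e (top_elt L);
          B = interval L (bottom_elt L) e';
          C = (\<lambda>k::nat. interval L (lo k) (hi k))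
        in is_atom L h e \<and> is_complement L e e' \<and>
           (\<forall>k\<in>J. is_atom L h (lo k) \<and> is_coatom L h (hi k) \<and> lo k \<subseteq> hi k) \<and>
           L = A \<union> B \<union> (\<Union>k\<in>J. C k) \<and>
           A \<inter> B = {} \<and> (\<forall>k\<in>J. A \<inter> C k = {} \<and> B \<inter> C k = {}) \<and>
           disjoint_family_on C J)"

end

theory Submission
  imports Defs
begin

text \<open>
  The Tutte partition is built by recursion on intervals \<open>[a, b]\<close> whose lower end \<open>a\<close> is independent
  and whose upper end \<open>b\<close> has full rank, starting with the whole lattice. A prime-free interval is
  kept. Any other interval is cut into shorter ones by a proper interval decomposition relative to
  an atom \<open>e\<close> and a complementary coatom \<open>f\<close> of the interval. Two things have to be shown: that \<open>e\<close> and
  \<open>f\<close> can be chosen so that the parts have independent lower ends and upper ends of full rank, and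
  that a decomposition along this particular pair exists.

  The choice of the pair is a matter of loops and coloops. In the decomposition, the lower ends are \<open>a\<close>
  and atoms outside \<open>f\<close>, and the upper ends are \<open>b\<close> and coatoms not above \<open>e\<close>. So \<open>f\<close> should contain the
  join \<open>l\<close> of all loops of the interval, and \<open>e\<close> should lie in the meet \<open>d\<close> of all coatoms of deficient
  rank. Such a complementary pair exists unless \<open>d \<subseteq> l\<close>. But \<open>d \<subseteq> l\<close> says that the interval is free over
  its loops, and then it has no prime diamond (\<open>prime_free_if_free_over_loops\<close>). This is
  \<open>splitting_pair_exists\<close>, and \<open>tutte_partition_if_splittings\<close> carries out the recursion; both hold
  in any modular lattice of sets in which adjoining a point climbs one step.

  For the second point, a Boolean interval splits along the pair according to whether the point that
  \<open>e\<close> adds belongs to a set. For subspaces, the given decomposition of the whole space is pulled back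
  to \<open>[a, b]\<close> along a linear map that has kernel \<open>a\<close> on \<open>b\<close> and carries \<open>e\<close> and \<open>f\<close> to the atom and into the
  hyperplane of the given decomposition (\<open>splitting_subspaces_transfer\<close>).
\<close>

section \<open>Splittings of an interval\<close>

lemma partition_on_refine:
  assumes "partition_on A Q" and "\<And>I. I \<in> Q \<Longrightarrow> partition_on I (F I)"
  shows "partition_on A (\<Union>I\<in>Q. F I)"
proof (rule partition_onI)
  have "\<Union>(F I) = I" if "I \<in> Q" for I
    using assms(2)[OF that] by (simp add: partition_on_def)
  then have "(\<Union>I\<in>Q. \<Union>(F I)) = A"
    using partition_onD1[OF assms(1)] by simp
  then show "\<Union>(\<Union>I\<in>Q. F I) = A"
    by blast
  show "{} \<notin> (\<Union>I\<in>Q. F I)"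
    using assms(2) partition_onD3 by blast
  fix p q assume "p \<in> (\<Union>I\<in>Q. F I)" "q \<in> (\<Union>I\<in>Q. F I)" and "p \<noteq> q"
  then obtain I J where IJ: "I \<in> Q" "p \<in> F I" "J \<in> Q" "q \<in> F J"
    by blast
  show "disjnt p q"
  proof (cases "I = J")
    case True
    then show ?thesis
      using partition_onD2[OF assms(2)[OF IJ(1)]] IJ \<open>p \<noteq> q\<close>
      by (auto simp: disjoint_def disjnt_def)
  next
    case False
    then have "I \<inter> J = {}"
      using partition_onD2[OF assms(1)] IJ by (auto simp: disjoint_def)
    moreover have "p \<subseteq> I" "q \<subseteq> J"
      using partition_onD1[OF assms(2)] IJ by blast+
    ultimately show ?thesis
      by (auto simp: disjnt_def)
  qed
qed

text \<open>
  This is a proper interval decomposition of the interval \<open>[a, b]\<close>, taken with respect to an atom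
  \<open>e\<close> and a complementary coatom \<open>f\<close> of \<open>[a, b]\<close>. The three kinds of parts \<open>[e, b]\<close>, \<open>[a, f]\<close> and
  [atom, coatom] are described at once: a lower end is \<open>a\<close> or an atom of \<open>[a, b]\<close> outside \<open>f\<close>, and an
  upper end is \<open>b\<close> or a coatom of \<open>[a, b]\<close> not above \<open>e\<close>. The two conditions on \<open>e\<close> and \<open>f\<close> are what
  disjointness from \<open>[a, f]\<close> and \<open>[e, b]\<close> gives for the remaining parts. Excluding \<open>[a, b]\<close> itself makes
  every part strictly shorter, so that a recursion over splittings ends.
\<close>

definition splitting ::
  "'a set set \<Rightarrow> ('a set \<Rightarrow> nat) \<Rightarrow> 'a set \<Rightarrow> 'a set \<Rightarrow> 'a set \<Rightarrow> 'a set \<Rightarrow> 'a set set set \<Rightarrow> bool" where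
  "splitting L h a b e f Q \<longleftrightarrow>
     partition_on (interval L a b) Q \<and>
     (\<forall>I\<in>Q. \<exists>x\<in>interval L a b. \<exists>y\<in>interval L a b. x \<subseteq> y \<and> I = interval L x y \<and> (x, y) \<noteq> (a, b) \<and>
        (x = a \<or> h x = h a + 1 \<and> \<not> x \<subseteq> f) \<and>
        (y = b \<or> h y + 1 = h b \<and> \<not> e \<subseteq> y))"

section \<open>Modular lattices of sets\<close>

text \<open>
  These axioms hold both for the subsets of a finite set with cardinality and for the subspaces of a
  finite-dimensional space with dimension. \<open>height_hull_insert\<close> says that adjoining one point climbs
  exactly one step; it makes the lattice atomistic and supplies all covers that are needed.
\<close>

locale support_lattice =
  fixes L :: "'a set set" and h :: "'a set \<Rightarrow> nat"
  assumes Inter_in: "A \<subseteq> L \<Longrightarrow> A \<noteq> {} \<Longrightarrow> \<Inter>A \<in> L"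
    and top_in: "top_elt L \<in> L"
    and height_bottom: "h (bottom_elt L) = 0"
    and height_mono: "x \<in> L \<Longrightarrow> y \<in> L \<Longrightarrow> x \<subseteq> y \<Longrightarrow> h x \<le> h y"
    and height_hull_insert:
      "x \<in> L \<Longrightarrow> p \<in> top_elt L \<Longrightarrow> p \<notin> x \<Longrightarrow> h ((\<lambda>z. z \<in> L) hull insert p x) = h x + 1"
    and height_modular:
      "x \<in> L \<Longrightarrow> y \<in> L \<Longrightarrow> h (join L x y) + h (x \<inter> y) = h x + h y"
begin

lemma subset_top: "x \<in> L \<Longrightarrow> x \<subseteq> top_elt L"
  by (auto simp: top_elt_def)

lemma bottom_in: "bottom_elt L \<in> L"
  using Inter_in[of L] top_in by (auto simp: bottom_elt_def)

lemma bottom_subset: "x \<in> L \<Longrightarrow> bottom_elt L \<subseteq> x"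
  by (auto simp: bottom_elt_def)

lemma Int_in: "x \<in> L \<Longrightarrow> y \<in> L \<Longrightarrow> x \<inter> y \<in> L"
  using Inter_in[of "{x, y}"] by simp

lemma hull_in_L: "X \<subseteq> top_elt L \<Longrightarrow> (\<lambda>z. z \<in> L) hull X \<in> L"
  unfolding hull_def using top_in by (intro Inter_in) auto

lemma join_in: "x \<in> L \<Longrightarrow> y \<in> L \<Longrightarrow> join L x y \<in> L"
  unfolding join_def using subset_top by (intro hull_in_L) auto

lemma subset_join: "x \<subseteq> join L x y" "y \<subseteq> join L x y"
  unfolding join_def using hull_subset[of "x \<union> y" "\<lambda>z. z \<in> L"] by auto

lemma join_least: "z \<in> L \<Longrightarrow> x \<subseteq> z \<Longrightarrow> y \<subseteq> z \<Longrightarrow> join L x y \<subseteq> z"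
  unfolding join_def by (intro hull_minimal) auto

lemma cover_through:
  assumes "x \<in> L" "y \<in> L" "x \<subseteq> y" "p \<in> y" "p \<notin> x"
  shows "\<exists>z. z \<in> L \<and> x \<subseteq> z \<and> z \<subseteq> y \<and> p \<in> z \<and> h z = h x + 1"
proof (intro exI conjI)
  let ?z = "(\<lambda>z. z \<in> L) hull insert p x"
  have p: "p \<in> top_elt L" using assms subset_top by blast
  show "?z \<in> L" using p assms subset_top by (intro hull_in_L) auto
  show "x \<subseteq> ?z" "p \<in> ?z"
    using hull_subset[of "insert p x" "\<lambda>z. z \<in> L"] by auto
  show "?z \<subseteq> y" using assms by (intro hull_minimal) auto
  show "h ?z = h x + 1" using height_hull_insert p assms by blast
qed

lemma height_strict_mono:
  assumes "x \<in> L" "y \<in> L" "x \<subset> y"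
  shows "h x < h y"
proof -
  obtain p where "p \<in> y" "p \<notin> x" using assms by blast
  then obtain z where "z \<in> L" "z \<subseteq> y" "h z = h x + 1"
    using cover_through[OF assms(1,2) psubset_imp_subset[OF assms(3)]] by metis
  then show ?thesis using height_mono[of z y] assms(2) by simp
qed

lemma eq_if_height_le: "x \<in> L \<Longrightarrow> y \<in> L \<Longrightarrow> x \<subseteq> y \<Longrightarrow> h y \<le> h x \<Longrightarrow> x = y"
  using height_strict_mono[of x y] by auto

text \<open>
  Take \<open>f\<close> of greatest height among the members of \<open>[x, b]\<close> that do not contain \<open>e\<close>. The join of \<open>f\<close>
  and \<open>e\<close> is one step above \<open>f\<close>. If it were not \<open>b\<close>, a point outside it would extend \<open>f\<close> by one step in
  a different direction, still without containing \<open>e\<close>.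
\<close>

lemma coatom_avoiding:
  assumes L: "a \<in> L" "b \<in> L" "e \<in> L" "x \<in> L"
    and sub: "a \<subseteq> x" "x \<subseteq> b" "a \<subseteq> e" "e \<subseteq> b"
    and e: "h e = h a + 1" "\<not> e \<subseteq> x"
  obtains f where "f \<in> L" "x \<subseteq> f" "f \<subseteq> b" "h f + 1 = h b" "\<not> e \<subseteq> f"
proof -
  let ?P = "\<lambda>f. f \<in> L \<and> x \<subseteq> f \<and> f \<subseteq> b \<and> \<not> e \<subseteq> f"
  have "?P x" using assms by simp
  moreover have "\<forall>f. ?P f \<longrightarrow> h f < h b + 1"
    using height_mono L by (auto simp: less_Suc_eq_le)
  ultimately obtain f where f: "?P f" and max: "\<And>f'. ?P f' \<Longrightarrow> h f' \<le> h f"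
    using ex_has_greatest_nat[of ?P x h "h b + 1"] by metis
  have "h (f \<inter> e) < h e"
    using f L by (intro height_strict_mono Int_in) auto
  moreover have "h a \<le> h (f \<inter> e)"
    using f L sub by (intro height_mono Int_in) auto
  ultimately have j: "h (join L f e) = h f + 1"
    using height_modular[of f e] f L e by simp
  have jb: "join L f e \<subseteq> b" using join_least f L sub by blast
  have "join L f e = b"
  proof (rule ccontr)
    assume "join L f e \<noteq> b"
    then obtain p where p: "p \<in> b" "p \<notin> join L f e" using jb by blast
    then have "p \<notin> f" using subset_join by blast
    then obtain g where g: "g \<in> L" "f \<subseteq> g" "g \<subseteq> b" "p \<in> g" "h g = h f + 1"
      using cover_through[OF _ _ _ p(1), of f] f L by metis
    show False
    proof (cases "e \<subseteq> g")
      case True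
      then have "join L f e \<subseteq> g" using join_least g by blast
      then have "join L f e = g"
        using join_in f L g j by (intro eq_if_height_le) auto
      then show False using g p by simp
    next
      case False
      then have "?P g" using g f by auto
      then show False using max[of g] g by simp
    qed
  qed
  then show thesis using that[of f] f j by simp
qed

end

section \<open>Loops, coloops and prime-free intervals\<close>

locale ranked_lattice = support_lattice +
  fixes r :: "'a set \<Rightarrow> nat"
  assumes rank: "rank_function L h r"
begin

lemma rank_le_height: "x \<in> L \<Longrightarrow> r x \<le> h x"
  and rank_mono: "x \<in> L \<Longrightarrow> y \<in> L \<Longrightarrow> x \<subseteq> y \<Longrightarrow> r x \<le> r y"
  and rank_submodular: "x \<in> L \<Longrightarrow> y \<in> L \<Longrightarrow> r (join L x y) + r (x \<inter> y) \<le> r x + r y"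
  using rank by (auto simp: rank_function_def)

text \<open>
  Climbing one step amounts to joining with an atom, whose rank is at most \<open>1\<close>; submodularity then
  bounds the increase of \<open>r\<close> by the increase of \<open>h\<close>.
\<close>

lemma rank_increase_le:
  assumes "x \<in> L" "y \<in> L" "x \<subseteq> y"
  shows "r y + h x \<le> r x + h y"
  using assms
proof (induction "h y - h x" arbitrary: x rule: less_induct)
  case less
  show ?case
  proof (cases "x = y")
    case False
    then obtain p where p: "p \<in> y" "p \<notin> x" using less.prems by blast
    obtain z where z: "z \<in> L" "x \<subseteq> z" "z \<subseteq> y" "p \<in> z" "h z = h x + 1"
      using cover_through[OF less.prems p] by metis
    have "p \<notin> bottom_elt L" using p bottom_subset less.prems by blast
    then obtain t where t: "t \<in> L" "t \<subseteq> z" "p \<in> t" "h t = h (bottom_elt L) + 1"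
      using cover_through[OF bottom_in z(1) bottom_subset[OF z(1)] z(4)] by metis
    have "join L x t = z"
    proof (rule eq_if_height_le)
      have "x \<subset> join L x t" using subset_join p t(3) by blast
      then show "h z \<le> h (join L x t)"
        using height_strict_mono[of x "join L x t"] join_in less.prems t z by simp
    qed (use join_in join_least less.prems t z in auto)
    then have "r z \<le> r x + 1"
      using rank_submodular[of x t] rank_le_height[of t] less.prems t height_bottom by simp
    moreover have "h z \<le> h y" using height_mono less.prems z by blast
    moreover from this have "r y + h z \<le> r z + h y"
      using z less.prems by (intro less.hyps) auto
    ultimately show ?thesis
      using z(5) by linarith
  qed simp
qed

text \<open>
  The member \<open>l\<close> is the join of the loops of the minor on \<open>[a, b]\<close>. It exists because submodularity
  closes the members of rank \<open>r a\<close> under joins. An atom of \<open>[a, b]\<close> that is not below \<open>l\<close> raises the rank.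
\<close>

lemma largest_of_equal_rank:
  assumes "a \<in> L" "b \<in> L" "a \<subseteq> b"
  obtains l where "l \<in> interval L a b" "r l = r a"
    "\<And>z. z \<in> interval L a b \<Longrightarrow> r z = r a \<Longrightarrow> z \<subseteq> l"
proof -
  let ?P = "\<lambda>z. z \<in> interval L a b \<and> r z = r a"
  have "?P a" using assms by (simp add: interval_def)
  moreover have "\<forall>z. ?P z \<longrightarrow> h z < h b + 1"
    using height_mono assms by (auto simp: interval_def less_Suc_eq_le)
  ultimately obtain l where l: "?P l" and max: "\<And>z. ?P z \<Longrightarrow> h z \<le> h l"
    using ex_has_greatest_nat[of ?P a h "h b + 1"] by metis
  show thesis
  proof (rule that)
    fix z assume z: "z \<in> interval L a b" "r z = r a"
    have in_L: "join L l z \<in> L" "l \<inter> z \<in> L" "l \<in> L" "z \<in> L"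
      using l z join_in Int_in by (auto simp: interval_def)
    have "r a \<le> r (l \<inter> z)"
      using l z assms in_L by (intro rank_mono) (auto simp: interval_def)
    moreover have "r a \<le> r (join L l z)"
      using l assms in_L subset_join(1)[of l z] by (intro rank_mono) (auto simp: interval_def)
    ultimately have "r (join L l z) = r a"
      using rank_submodular[of l z] l z in_L by simp
    moreover have "join L l z \<subseteq> b"
      using l z assms by (intro join_least) (auto simp: interval_def)
    ultimately have "?P (join L l z)"
      using in_L subset_join(1)[of l z] l by (auto simp: interval_def)
    then have "l = join L l z"
      using max in_L subset_join by (intro eq_if_height_le) auto
    then show "z \<subseteq> l" using subset_join by metis
  qed (use l in auto)
qed

text \<open>
  Dually, the member \<open>d\<close> is the meet of the coatoms of \<open>[a, b]\<close> whose rank is smaller than \<open>r b\<close>.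
  The members from which rank and height grow equally up to \<open>b\<close> are closed under meets, because the
  height is modular, the rank is submodular and never grows faster than the height. A coatom of \<open>[a, b]\<close> that does not contain \<open>d\<close> has
  full rank.
\<close>

lemma smallest_with_free_quotient:
  assumes "a \<in> L" "b \<in> L" "a \<subseteq> b"
  obtains d where "d \<in> interval L a b" "r b + h d = r d + h b"
    "\<And>w. w \<in> interval L a b \<Longrightarrow> r b + h w = r w + h b \<Longrightarrow> d \<subseteq> w"
proof -
  let ?P = "\<lambda>w. w \<in> interval L a b \<and> r b + h w = r w + h b"
  have "?P b" using assms by (simp add: interval_def)
  then obtain d where d: "?P d" and min: "\<And>w. ?P w \<Longrightarrow> h d \<le> h w"
    using ex_has_least_nat[of ?P b h] by metis
  show thesis
  proof (rule that)
    fix w assume w: "w \<in> interval L a b" "r b + h w = r w + h b"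
    have in_L: "join L d w \<in> L" "d \<inter> w \<in> L" "d \<in> L" "w \<in> L"
      using d w join_in Int_in by (auto simp: interval_def)
    have "join L d w \<subseteq> b"
      using d w assms by (intro join_least) (auto simp: interval_def)
    then have "r b + h (join L d w) \<le> r (join L d w) + h b"
      using in_L assms by (intro rank_increase_le)
    moreover have "r b + h (d \<inter> w) \<le> r (d \<inter> w) + h b"
      using in_L d assms by (intro rank_increase_le) (auto simp: interval_def)
    ultimately have "r b + h (d \<inter> w) = r (d \<inter> w) + h b"
      using rank_submodular[of d w] height_modular[of d w] d w in_L by linarith
    then have "?P (d \<inter> w)"
      using in_L d w by (auto simp: interval_def)
    then have "d \<inter> w = d"
      using min in_L by (intro eq_if_height_le) auto
    then show "d \<subseteq> w" by blast
  qed (use d in auto)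
qed

text \<open>
  If rank and height grow equally from the join \<open>l\<close> of the loops up to \<open>b\<close>, the minor is a direct sum of
  loops and a free part: \<open>r x\<close> is \<open>r a\<close> plus the height of \<open>x\<close> over its meet with \<open>l\<close>. A prime diamond
  \<open>[c, d]\<close> would gain exactly one step inside \<open>l\<close>, and then joining \<open>c\<close> with the meet of \<open>d\<close> and \<open>l\<close>
  gives an intermediate member of rank \<open>r c\<close>, against primeness.
\<close>

lemma prime_free_if_free_over_loops:
  assumes ab: "a \<in> L" "b \<in> L" "a \<subseteq> b"
    and l: "l \<in> interval L a b" "r l = r a"
    and free: "r b + h l = r l + h b"
  shows "prime_free L h r a b"
  unfolding prime_free_def
proof clarify
  fix c d assume prime: "prime_diamond L h r c d" and cd: "a \<subseteq> c" "d \<subseteq> b"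
  have l_in: "l \<in> L" "a \<subseteq> l" "l \<subseteq> b" using l by (auto simp: interval_def)
  \<comment> \<open>Submodularity for \<open>x\<close> and \<open>l\<close> shows that joining with \<open>l\<close> does not change the rank of \<open>x\<close>.\<close>
  have rank_eq: "r x + h (x \<inter> l) = r a + h x" if x: "x \<in> L" "a \<subseteq> x" "x \<subseteq> b" for x
  proof -
    have in_L: "join L x l \<in> L" "x \<inter> l \<in> L" using x l_in join_in Int_in by auto
    have "join L x l \<subseteq> b" using x l_in ab by (intro join_least) auto
    then have "r b + h (join L x l) \<le> r (join L x l) + h b"
      using in_L ab by (intro rank_increase_le)
    moreover have "r (join L x l) + h l \<le> r l + h (join L x l)"
      using in_L l_in subset_join by (intro rank_increase_le)
    ultimately have "r (join L x l) + h l = r l + h (join L x l)"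
      using free by linarith
    moreover have "r a \<le> r (x \<inter> l)"
      using in_L x l_in ab by (intro rank_mono) auto
    moreover have "r x \<le> r (join L x l)"
      using in_L x subset_join by (intro rank_mono) auto
    ultimately show ?thesis
      using rank_submodular[of x l] height_modular[of x l] x l_in l(2) by linarith
  qed
  have cd_in: "c \<in> L" "d \<in> L" "c \<subseteq> d" "h d = h c + 2"
    using prime by (auto simp: prime_diamond_def diamond_def)
  have between: "r x = r c + 1 \<and> r d = r x" if "x \<in> L" "c \<subset> x" "x \<subset> d" for x
    using prime that by (auto simp: prime_diamond_def)
  have "c \<noteq> d" using cd_in(4) by auto
  then obtain p where p: "p \<in> d" "p \<notin> c" using cd_in(3) by blast
  then obtain z where z: "z \<in> L" "c \<subseteq> z" "z \<subseteq> d" "h z = h c + 1"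
    using cover_through[OF cd_in(1-3) p] by metis
  then have "c \<subset> z" "z \<subset> d" using cd_in by auto
  then have rd: "r d = r c + 1" using between z by auto
  have ac: "r c + h (c \<inter> l) = r a + h c" "r d + h (d \<inter> l) = r a + h d"
    using rank_eq cd_in cd by auto
  define x where "x = join L c (d \<inter> l)"
  have in_L: "c \<in> L" "d \<inter> l \<in> L" "x \<in> L" using cd_in l_in Int_in join_in by (auto simp: x_def)
  have "c \<inter> (d \<inter> l) = c \<inter> l" using cd_in by blast
  then have "h x = h c + 1"
    using height_modular[OF in_L(1,2)] ac rd cd_in by (simp add: x_def)
  moreover have sub: "c \<subseteq> x" "x \<subseteq> d" "d \<inter> l \<subseteq> x"
    using subset_join join_least cd_in by (auto simp: x_def)
  ultimately have "c \<subset> x" "x \<subset> d" using cd_in by auto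
  then have "r x = r c + 1" using between in_L by auto
  moreover have "r x + h (x \<inter> l) = r a + h x"
    using rank_eq in_L sub cd by blast
  moreover have "h (d \<inter> l) \<le> h (x \<inter> l)"
    using in_L l_in sub Int_in by (intro height_mono) auto
  ultimately show False
    using \<open>h x = h c + 1\<close> ac rd cd_in by linarith
qed

text \<open>
  With \<open>l\<close> the join of the loops and \<open>d\<close> the meet of the deficient coatoms, \<open>d \<subseteq> l\<close> would make the
  interval prime-free. Otherwise some atom \<open>e\<close> lies below \<open>d\<close> but not below \<open>l\<close>, and some coatom \<open>f\<close> lies
  above \<open>l\<close> but not above \<open>e\<close>. Then an atom outside \<open>f\<close> is no loop, and a coatom not above \<open>e\<close> is
  not above \<open>d\<close> either and so not deficient. Thus every end point that a splitting along \<open>e\<close> and \<open>f\<close> can have is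
  independent or of full rank, as required.
\<close>

lemma splitting_pair_exists:
  assumes ab: "a \<in> L" "b \<in> L" "a \<subseteq> b" and "\<not> prime_free L h r a b"
  obtains e f where "e \<in> interval L a b" "f \<in> interval L a b"
    "h e = h a + 1" "h f + 1 = h b" "\<not> e \<subseteq> f"
    "\<And>x. x \<in> interval L a b \<Longrightarrow> h x = h a + 1 \<Longrightarrow> \<not> x \<subseteq> f \<Longrightarrow> r x = r a + 1"
    "\<And>y. y \<in> interval L a b \<Longrightarrow> h y + 1 = h b \<Longrightarrow> \<not> e \<subseteq> y \<Longrightarrow> r y = r b"
proof -
  obtain l where l: "l \<in> interval L a b" "r l = r a"
    and l_max: "\<And>z. z \<in> interval L a b \<Longrightarrow> r z = r a \<Longrightarrow> z \<subseteq> l"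
    using largest_of_equal_rank[OF ab] by blast
  obtain d where d: "d \<in> interval L a b" "r b + h d = r d + h b"
    and d_min: "\<And>w. w \<in> interval L a b \<Longrightarrow> r b + h w = r w + h b \<Longrightarrow> d \<subseteq> w"
    using smallest_with_free_quotient[OF ab] by blast
  have in_L: "l \<in> L" "a \<subseteq> l" "l \<subseteq> b" "d \<in> L" "a \<subseteq> d" "d \<subseteq> b"
    using l d by (auto simp: interval_def)
  have "\<not> d \<subseteq> l"
  proof
    assume "d \<subseteq> l"
    then have "r l + h d \<le> r d + h l" "r b + h l \<le> r l + h b"
      using in_L ab by (auto intro!: rank_increase_le)
    then have "r b + h l = r l + h b" using d by linarith
    then show False using prime_free_if_free_over_loops assms l by blast
  qed
  then obtain p where p: "p \<in> d" "p \<notin> l" by blast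
  moreover have "p \<notin> a" using p in_L by blast
  ultimately obtain e where e: "e \<in> L" "a \<subseteq> e" "e \<subseteq> d" "p \<in> e" "h e = h a + 1"
    using cover_through[of a d p] ab in_L by metis
  have e_not: "\<not> e \<subseteq> l" "e \<subseteq> b" using e p in_L by auto
  obtain f where f: "f \<in> L" "l \<subseteq> f" "f \<subseteq> b" "h f + 1 = h b" "\<not> e \<subseteq> f"
    using coatom_avoiding[of a b e l] ab in_L e e_not by blast
  show thesis
  proof (rule that)
    show "e \<in> interval L a b" "f \<in> interval L a b"
      using e e_not f in_L by (auto simp: interval_def)
    fix x assume x: "x \<in> interval L a b"
    then have x_in: "x \<in> L" "a \<subseteq> x" "x \<subseteq> b" by (auto simp: interval_def)
    have incr: "r x + h a \<le> r a + h x" "r b + h x \<le> r x + h b" "r a \<le> r x" "r x \<le> r b"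
      using rank_increase_le rank_mono x_in ab by auto
    show "r x = r a + 1" if "h x = h a + 1" "\<not> x \<subseteq> f"
    proof -
      have "r x \<noteq> r a" using l_max[OF x] f that by blast
      then show ?thesis using incr that by linarith
    qed
    show "r x = r b" if "h x + 1 = h b" "\<not> e \<subseteq> x"
    proof -
      have "r b + h x \<noteq> r x + h b" using d_min[OF x] e that by blast
      then show ?thesis using incr that by linarith
    qed
  qed (use e f in auto)
qed

text \<open>
  The recursion runs over intervals \<open>[a, b]\<close> with \<open>a\<close> independent and \<open>b\<close> of full rank: a prime-free one is
  kept, any other is split along a pair from \<open>splitting_pair_exists\<close> into strictly shorter intervals
  of the same kind.
\<close>

theorem tutte_partition_if_splittings:
  assumes splittings: "\<And>a b e f. \<lbrakk>a \<in> L; b \<in> L; e \<in> interval L a b; f \<in> interval L a b;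
      h e = h a + 1; h f + 1 = h b; \<not> e \<subseteq> f\<rbrakk> \<Longrightarrow> \<exists>Q. splitting L h a b e f Q"
  shows "\<exists>P. tutte_partition L h r P"
proof -
  define good where "good I \<longleftrightarrow> (\<exists>a\<in>L. \<exists>b\<in>L. a \<subseteq> b \<and> I = interval L a b \<and>
      r a = h a \<and> r b = r (top_elt L) \<and> prime_free L h r a b)" for I
  have "\<exists>P. partition_on (interval L a b) P \<and> (\<forall>I\<in>P. good I)"
    if "a \<in> L" "b \<in> L" "a \<subseteq> b" "r a = h a" "r b = r (top_elt L)" for a b
    using that
  proof (induction "h b - h a" arbitrary: a b rule: less_induct)
    case less
    note ab = less.prems
    show ?case
    proof (cases "prime_free L h r a b")
      case True
      have "partition_on (interval L a b) {interval L a b}"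
        using ab by (intro partition_on_space) (auto simp: interval_def)
      moreover have "good (interval L a b)" unfolding good_def using True ab by blast
      ultimately show ?thesis by blast
    next
      case False
      obtain e f where ef: "e \<in> interval L a b" "f \<in> interval L a b"
          "h e = h a + 1" "h f + 1 = h b" "\<not> e \<subseteq> f"
        and atom: "\<And>x. x \<in> interval L a b \<Longrightarrow> h x = h a + 1 \<Longrightarrow> \<not> x \<subseteq> f \<Longrightarrow> r x = r a + 1"
        and coatom: "\<And>y. y \<in> interval L a b \<Longrightarrow> h y + 1 = h b \<Longrightarrow> \<not> e \<subseteq> y \<Longrightarrow> r y = r b"
        by (rule splitting_pair_exists[OF ab(1-3) False]) (rule that)
      obtain Q where Q: "splitting L h a b e f Q"
        using splittings[OF ab(1,2) ef] by blast
      have "\<exists>P. partition_on I P \<and> (\<forall>I\<in>P. good I)" if I: "I \<in> Q" for I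
      proof -
        obtain x y where xy: "x \<in> interval L a b" "y \<in> interval L a b" "x \<subseteq> y"
            "I = interval L x y" "(x, y) \<noteq> (a, b)"
            "x = a \<or> h x = h a + 1 \<and> \<not> x \<subseteq> f" "y = b \<or> h y + 1 = h b \<and> \<not> e \<subseteq> y"
          using bspec[OF conjunct2[OF Q[unfolded splitting_def]] I] by (elim bexE conjE) (rule that)
        have in_L: "x \<in> L" "y \<in> L" "a \<subseteq> x" "y \<subseteq> b"
          using xy by (auto simp: interval_def)
        have "r x = h x" "r y = r (top_elt L)"
          using xy(6,7) atom[OF xy(1)] coatom[OF xy(2)] ab(4,5) by metis+
        moreover have "h y - h x < h b - h a"
        proof -
          have "h a \<le> h x" "h x \<le> h y" "h y \<le> h b"
            using in_L xy(3) ab by (auto intro!: height_mono)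
          then show ?thesis using xy(5-7) by auto
        qed
        ultimately show ?thesis
          unfolding xy(4) using in_L xy(3) by (intro less.hyps) auto
      qed
      then have "\<forall>I\<in>Q. \<exists>P. partition_on I P \<and> (\<forall>J\<in>P. good J)"
        by (intro ballI)
      from bchoice[OF this] obtain F where F: "\<forall>I\<in>Q. partition_on I (F I) \<and> (\<forall>J\<in>F I. good J)"
        by (elim exE) (rule that)
      have "partition_on (interval L a b) (\<Union>I\<in>Q. F I)"
        using Q F by (intro partition_on_refine) (auto simp: splitting_def)
      moreover have "\<forall>J\<in>(\<Union>I\<in>Q. F I). good J" using F by blast
      ultimately show ?thesis by blast
    qed
  qed
  moreover have "r (bottom_elt L) = h (bottom_elt L)"
    using rank_le_height[OF bottom_in] height_bottom by simp
  ultimately have "\<exists>P. partition_on (interval L (bottom_elt L) (top_elt L)) P \<and> (\<forall>I\<in>P. good I)"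
    using bottom_in top_in bottom_subset[OF top_in] by simp
  moreover have "interval L (bottom_elt L) (top_elt L) = L"
    using bottom_subset subset_top by (auto simp: interval_def)
  ultimately show ?thesis
    unfolding tutte_partition_def good_def by simp
qed

end

section \<open>From the given decomposition to a splitting\<close>

text \<open>
  An atom \<open>lo k\<close> below the complement \<open>f\<close> of \<open>e\<close> would belong to \<open>[bottom, f]\<close>, and a coatom \<open>hi k\<close> above \<open>e\<close> to
  \<open>[e, top]\<close>; disjointness of the parts excludes both.
\<close>

lemma (in support_lattice) splitting_if_decomposition:
  assumes "has_proper_interval_decomposition L h q"
  obtains e f Q where "e \<in> L" "f \<in> L" "h e = 1" "h f + 1 = h (top_elt L)" "\<not> e \<subseteq> f"
    "splitting L h (bottom_elt L) (top_elt L) e f Q"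
proof -
  define J where "J = {1..q ^ (h (top_elt L) - 1) - 1}"
  from assms[unfolded has_proper_interval_decomposition_def Let_def, folded J_def]
  obtain e f lo hi where dec: "is_atom L h e \<and> is_complement L e f \<and>
      (\<forall>k\<in>J. is_atom L h (lo k) \<and> is_coatom L h (hi k) \<and> lo k \<subseteq> hi k) \<and>
      L = interval L e (top_elt L) \<union> interval L (bottom_elt L) f \<union> (\<Union>k\<in>J. interval L (lo k) (hi k)) \<and>
      interval L e (top_elt L) \<inter> interval L (bottom_elt L) f = {} \<and>
      (\<forall>k\<in>J. interval L e (top_elt L) \<inter> interval L (lo k) (hi k) = {} \<and>
        interval L (bottom_elt L) f \<inter> interval L (lo k) (hi k) = {}) \<and>
      disjoint_family_on (\<lambda>k. interval L (lo k) (hi k)) J"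
    by (elim exE) (rule that)
  define A B C where ABC: "A = interval L e (top_elt L)" "B = interval L (bottom_elt L) f"
    "C = (\<lambda>k. interval L (lo k) (hi k))"
  have e: "e \<in> L" "h e = 1" and f: "f \<in> L" and ef: "e \<inter> f = bottom_elt L" "join L e f = top_elt L"
    and lohi: "\<And>k. k \<in> J \<Longrightarrow> lo k \<in> L \<and> h (lo k) = 1 \<and> hi k \<in> L \<and> h (hi k) + 1 = h (top_elt L) \<and> lo k \<subseteq> hi k"
    and cover: "L = A \<union> B \<union> (\<Union>k\<in>J. C k)" and AB: "A \<inter> B = {}"
    and AC: "\<And>k. k \<in> J \<Longrightarrow> A \<inter> C k = {}" and BC: "\<And>k. k \<in> J \<Longrightarrow> B \<inter> C k = {}"
    and CC: "disjoint_family_on C J"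
    using dec unfolding ABC is_atom_def is_coatom_def is_complement_def by simp_all
  have hf: "h f + 1 = h (top_elt L)"
    using height_modular[OF e(1) f] ef e(2) height_bottom by simp
  have not_ef: "\<not> e \<subseteq> f"
  proof
    assume "e \<subseteq> f"
    then have "e = bottom_elt L" using ef(1) by blast
    then show False using e(2) height_bottom by simp
  qed
  have lo_not: "\<not> lo k \<subseteq> f" if "k \<in> J" for k
  proof
    assume "lo k \<subseteq> f"
    then have "lo k \<in> B \<inter> C k"
      using lohi[OF that] bottom_subset by (auto simp: ABC interval_def)
    then show False using BC[OF that] by blast
  qed
  have hi_not: "\<not> e \<subseteq> hi k" if "k \<in> J" for k
  proof
    assume "e \<subseteq> hi k"
    then have "hi k \<in> A \<inter> C k"
      using lohi[OF that] subset_top[of "hi k"] by (auto simp: ABC interval_def)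
    then show False using AC[OF that] by blast
  qed
  have bt: "interval L (bottom_elt L) (top_elt L) = L"
    using bottom_subset subset_top by (auto simp: interval_def)
  have part: "partition_on L ({A, B} \<union> C ` J)"
  proof (rule partition_onI)
    show "\<Union> ({A, B} \<union> C ` J) = L" using cover by auto
    have "e \<in> A" "f \<in> B" using e f subset_top[OF e(1)] bottom_subset[OF f] by (auto simp: ABC interval_def)
    moreover have "lo k \<in> C k" if "k \<in> J" for k using lohi[OF that] by (auto simp: ABC interval_def)
    ultimately show "{} \<notin> {A, B} \<union> C ` J" by auto
    fix p q assume "p \<in> {A, B} \<union> C ` J" "q \<in> {A, B} \<union> C ` J" "p \<noteq> q"
    moreover have "C k \<inter> C m = {}" if "k \<in> J" "m \<in> J" "C k \<noteq> C m" for k m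
      using CC that unfolding disjoint_family_on_def by metis
    ultimately show "disjnt p q"
      using AB AC BC unfolding disjnt_def
      by (elim UnE imageE insertE emptyE) (simp_all add: Int_commute)
  qed
  have ne: "e \<noteq> bottom_elt L" "f \<noteq> top_elt L" "\<And>k. k \<in> J \<Longrightarrow> lo k \<noteq> bottom_elt L"
    using e(2) hf lohi height_bottom by force+
  have members: "\<exists>x\<in>L. \<exists>y\<in>L. x \<subseteq> y \<and> I = interval L x y \<and> (x, y) \<noteq> (bottom_elt L, top_elt L) \<and>
        (x = bottom_elt L \<or> h x = h (bottom_elt L) + 1 \<and> \<not> x \<subseteq> f) \<and>
        (y = top_elt L \<or> h y + 1 = h (top_elt L) \<and> \<not> e \<subseteq> y)" if "I \<in> {A, B} \<union> C ` J" for I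
  proof -
    consider "I = A" | "I = B" | k where "k \<in> J" "I = C k" using \<open>I \<in> _\<close> by blast
    then show ?thesis
    proof cases
      case 1
      then show ?thesis
        using e ne(1) not_ef height_bottom top_in subset_top[OF e(1)]
        by (intro bexI[of _ e] bexI[of _ "top_elt L"]) (simp_all add: ABC)
    next
      case 2
      then show ?thesis
        using f hf ne(2) not_ef bottom_in bottom_subset[OF f]
        by (intro bexI[of _ "bottom_elt L"] bexI[of _ f]) (simp_all add: ABC)
    next
      case 3
      then show ?thesis
        using lohi[OF 3(1)] lo_not[OF 3(1)] hi_not[OF 3(1)] ne(3)[OF 3(1)] height_bottom
        by (intro bexI[of _ "lo k"] bexI[of _ "hi k"]) (simp_all add: ABC)
    qed
  qed
  have "splitting L h (bottom_elt L) (top_elt L) e f ({A, B} \<union> C ` J)"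
    unfolding splitting_def bt by (intro conjI ballI part members)
  then show thesis by (rule that[OF e(1) f e(2) hf not_ef])
qed

section \<open>The Boolean lattice\<close>

lemma support_lattice_Pow:
  assumes "finite S"
  shows "support_lattice (Pow S) card"
proof
  have hull: "(\<lambda>z. z \<in> Pow S) hull x = x" if "x \<subseteq> S" for x
    using that by (intro hull_same) simp
  have fin: "finite x" if "x \<in> Pow S" for x
    using that assms finite_subset by blast
  show "top_elt (Pow S) \<in> Pow S" by (simp add: top_elt_def)
  have "bottom_elt (Pow S) = {}" unfolding bottom_elt_def by blast
  then show "card (bottom_elt (Pow S)) = 0" by simp
  show "\<Inter>A \<in> Pow S" if "A \<subseteq> Pow S" "A \<noteq> {}" for A
    using that by blast
  fix x y assume x: "x \<in> Pow S" and y: "y \<in> Pow S"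
  show "card x \<le> card y" if "x \<subseteq> y" using that fin y by (intro card_mono)
  have "join (Pow S) x y = x \<union> y"
    unfolding join_def using x y by (intro hull) auto
  then show "card (join (Pow S) x y) + card (x \<inter> y) = card x + card y"
    using card_Un_Int[OF fin[OF x] fin[OF y]] by simp
next
  fix x p assume "x \<in> Pow S" "p \<in> top_elt (Pow S)" "p \<notin> x"
  then show "card ((\<lambda>z. z \<in> Pow S) hull insert p x) = card x + 1"
    using assms finite_subset[of x S] hull_same[of "\<lambda>z. z \<in> Pow S" "insert p x"]
    by (simp add: top_elt_def)
qed

text \<open>
  In a Boolean interval the atom \<open>e\<close> adds one point \<open>p\<close> to \<open>a\<close> and the coatom \<open>f\<close> removes the same point
  from \<open>b\<close>, so the two parts are the sets that contain \<open>p\<close> and those that do not.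
\<close>

lemma splitting_Pow:
  assumes S: "finite S" and ab: "a \<in> Pow S" "b \<in> Pow S"
    and e: "e \<in> interval (Pow S) a b" "card e = card a + 1"
    and f: "f \<in> interval (Pow S) a b" "card f + 1 = card b" and ef: "\<not> e \<subseteq> f"
  shows "splitting (Pow S) card a b e f {interval (Pow S) e b, interval (Pow S) a f}"
proof -
  obtain p where p: "p \<in> e" "p \<notin> f" using ef by blast
  have fin: "finite a" "finite b" "finite e" "finite f"
    using ab e f by (auto simp: interval_def intro: finite_subset[OF _ S])
  have sub: "a \<subseteq> e" "e \<subseteq> b" "a \<subseteq> f" "f \<subseteq> b" "e \<subseteq> S" "f \<subseteq> S"
    using e f by (auto simp: interval_def)
  have e_eq: "insert p a = e"
  proof (rule card_subset_eq)
    show "card (insert p a) = card e" using fin p sub e(2) by (subst card_insert_disjoint) auto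
  qed (use fin p sub in auto)
  have "card (insert p f) = card b" using fin p sub f(2) by simp
  then have b_eq: "insert p f = b"
    using fin p sub by (intro card_subset_eq) auto
  have e_iff: "e \<subseteq> x \<longleftrightarrow> p \<in> x \<and> a \<subseteq> x" for x
    unfolding e_eq[symmetric] by simp
  have f_iff: "x \<subseteq> f \<longleftrightarrow> p \<notin> x \<and> x \<subseteq> b" for x
    unfolding b_eq[symmetric] using p by blast
  have part: "partition_on (interval (Pow S) a b) {interval (Pow S) e b, interval (Pow S) a f}"
  proof (rule partition_onI)
    show "\<Union> {interval (Pow S) e b, interval (Pow S) a f} = interval (Pow S) a b"
      by (auto simp: interval_def e_iff f_iff)
    have "e \<in> interval (Pow S) e b" "f \<in> interval (Pow S) a f"
      using sub by (simp_all add: interval_def)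
    then show "{} \<notin> {interval (Pow S) e b, interval (Pow S) a f}" by blast
    have "interval (Pow S) e b \<inter> interval (Pow S) a f = {}"
      unfolding interval_def e_iff f_iff by blast
    then show "disjnt x y" if "x \<in> {interval (Pow S) e b, interval (Pow S) a f}"
      "y \<in> {interval (Pow S) e b, interval (Pow S) a f}" "x \<noteq> y" for x y
      using that unfolding disjnt_def by blast
  qed
  have "a \<subseteq> b" using sub by blast
  then have mem: "a \<in> interval (Pow S) a b" "b \<in> interval (Pow S) a b"
    using ab by (simp_all add: interval_def)
  have "e \<noteq> a" "f \<noteq> b" using e(2) f(2) by auto
  show ?thesis
    unfolding splitting_def
  proof (intro conjI ballI part)
    fix I assume "I \<in> {interval (Pow S) e b, interval (Pow S) a f}"
    then consider "I = interval (Pow S) e b" | "I = interval (Pow S) a f" by blast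
    then show "\<exists>x\<in>interval (Pow S) a b. \<exists>y\<in>interval (Pow S) a b. x \<subseteq> y \<and> I = interval (Pow S) x y \<and>
        (x, y) \<noteq> (a, b) \<and> (x = a \<or> card x = card a + 1 \<and> \<not> x \<subseteq> f) \<and>
        (y = b \<or> card y + 1 = card b \<and> \<not> e \<subseteq> y)"
    proof cases
      case 1
      then show ?thesis
        using e ef sub mem \<open>e \<noteq> a\<close> by (intro bexI[of _ e] bexI[of _ b]) simp_all
    next
      case 2
      then show ?thesis
        using f ef sub mem \<open>f \<noteq> b\<close> by (intro bexI[of _ a] bexI[of _ f]) simp_all
    qed
  qed
qed

section \<open>The lattice of subspaces\<close>

context finite_dimensional_vector_space
begin

lemma top_elt_subspaces: "top_elt (subspaces scale) = UNIV"
  using subspace_UNIV unfolding top_elt_def subspaces_def by blast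

lemma bottom_elt_subspaces: "bottom_elt (subspaces scale) = {0}"
  using subspace_0 subspace_single_0 unfolding bottom_elt_def subspaces_def by blast

lemma support_lattice_subspaces: "support_lattice (subspaces scale) dim"
proof
  show "dim (bottom_elt (subspaces scale)) = 0" by (simp add: bottom_elt_subspaces)
  show "top_elt (subspaces scale) \<in> subspaces scale"
    unfolding top_elt_subspaces by (simp add: subspaces_def)
  show "\<Inter>A \<in> subspaces scale" if "A \<subseteq> subspaces scale" "A \<noteq> {}" for A
    using that subspace_Inter by (auto simp: subspaces_def)
  have hull: "(\<lambda>z. z \<in> subspaces scale) hull X = span X" for X
    by (simp add: subspaces_def span_def)
  fix x y assume "x \<in> subspaces scale" "y \<in> subspaces scale"
  then have sub: "subspace x" "subspace y" by (auto simp: subspaces_def)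
  show "dim x \<le> dim y" if "x \<subseteq> y" using that by (rule dim_subset)
  have "join (subspaces scale) x y = {u + v |u v. u \<in> x \<and> v \<in> y}"
    using sub by (simp add: join_def hull span_Un span_eq_iff[THEN iffD2])
  then show "dim (join (subspaces scale) x y) + dim (x \<inter> y) = dim x + dim y"
    using dim_sums_Int[OF sub] by simp
next
  fix x p assume "x \<in> subspaces scale" "p \<notin> x"
  then show "dim ((\<lambda>z. z \<in> subspaces scale) hull insert p x) = dim x + 1"
    by (simp add: subspaces_def span_def[symmetric] dim_insert span_eq_iff[THEN iffD2])
qed

text \<open>
  Extend a basis \<open>Ba\<close> of \<open>a\<close> to a basis \<open>Bf\<close> of \<open>f\<close>, and \<open>Bf\<close> to a basis of \<open>b\<close> by one vector \<open>v\<close> of \<open>e\<close>.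
  The map kills \<open>Ba\<close>, sends \<open>v\<close> to a vector of \<open>e0\<close> outside \<open>f0\<close>, and embeds the rest of \<open>Bf\<close> into a basis of
  \<open>f0\<close>, which is large enough because \<open>f0\<close> is a hyperplane of the whole space. Modulo \<open>a\<close>, this
  embeds \<open>b\<close> into the whole space and carries the pair \<open>(e, f)\<close> to \<open>e0\<close> and into \<open>f0\<close>.
\<close>

lemma linear_collapse_exists:
  assumes sub: "subspace a" "subspace b" "subspace e" "subspace f" "subspace e0" "subspace f0"
    and incl: "a \<subseteq> e" "e \<subseteq> b" "a \<subseteq> f" "f \<subseteq> b"
    and dims: "dim e = dim a + 1" "dim f + 1 = dim b" "dim e0 = 1" "dim f0 + 1 = dim UNIV"
    and compl: "\<not> e \<subseteq> f" "\<not> e0 \<subseteq> f0"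
  obtains G where "Vector_Spaces.linear scale scale G"
    "\<And>u. u \<in> b \<Longrightarrow> G u = 0 \<longleftrightarrow> u \<in> a" "e0 \<subseteq> G ` e" "G ` f \<subseteq> f0"
proof -
  interpret vector_space_pair scale scale by unfold_locales
  interpret support_lattice "subspaces scale" dim by (rule support_lattice_subspaces)
  obtain v where v: "v \<in> e" "v \<notin> f" using compl by blast
  obtain v0 where v0: "v0 \<in> e0" "v0 \<notin> f0" using compl by blast
  obtain Ba where Ba: "Ba \<subseteq> a" "independent Ba" "a \<subseteq> span Ba" "card Ba = dim a"
    using basis_exists[of a] by blast
  obtain Bf where Bf: "Ba \<subseteq> Bf" "Bf \<subseteq> f" "independent Bf" "f \<subseteq> span Bf"
    using maximal_independent_subset_extend[OF subset_trans[OF Ba(1) incl(3)] Ba(2)] by blast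
  obtain B0 where B0: "B0 \<subseteq> f0" "independent B0" "f0 \<subseteq> span B0" "card B0 = dim f0"
    using basis_exists[of f0] by blast
  have span_f: "span Bf = f" using span_minimal[OF Bf(2) sub(4)] Bf(4) by (rule equalityI)
  have span_a: "span Ba = a" using span_minimal[OF Ba(1) sub(1)] Ba(3) by (rule equalityI)
  have span_f0: "span B0 = f0" using span_minimal[OF B0(1) sub(6)] B0(3) by (rule equalityI)
  have fin: "finite Bf" "finite Ba" "finite B0"
    using Bf(3) Ba(2) B0(2) by (auto intro: finiteI_independent)
  have "card Bf = dim f" using dim_span_eq_card_independent[OF Bf(3)] span_f by simp
  then have "card (Bf - Ba) \<le> card B0"
    using card_Diff_subset[OF fin(2) Bf(1)] Ba(4) B0(4) dims dim_subset[of b UNIV] by simp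
  then obtain g where g: "g ` (Bf - Ba) \<subseteq> B0" "inj_on g (Bf - Ba)"
    using card_le_inj[of "Bf - Ba" B0] fin by blast
  define C where "C = insert v (Bf - Ba)"
  define G0 where "G0 u = (if u \<in> Ba then 0 else if u = v then v0 else g u)" for u
  have "v \<notin> span Bf" using v span_f by simp
  then have ind: "independent (insert v Bf)" using Bf by (intro independent_insertI)
  have vBf: "v \<notin> Bf" using v Bf by blast
  obtain G where G: "Vector_Spaces.linear scale scale G" "\<And>u. u \<in> insert v Bf \<Longrightarrow> G u = G0 u"
    using linear_independent_extend[OF ind, of G0] by blast
  interpret G: Vector_Spaces.linear scale scale G by (rule G)
  have Ga: "G u = 0" if "u \<in> a" for u
  proof -
    have "\<forall>u\<in>Ba. G u = 0" using G(2) Bf(1) by (auto simp: G0_def)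
    then show ?thesis using G.eq_0_on_span that span_a by blast
  qed
  have Gv: "G v = v0" using G(2)[of v] vBf Bf(1) by (auto simp: G0_def)
  have Gg: "G u = g u" if "u \<in> Bf - Ba" for u
    using G(2)[of u] that vBf by (auto simp: G0_def)
  have GC: "G ` C = insert v0 (g ` (Bf - Ba))"
    using Gv Gg by (auto simp: C_def)
  have v0_g: "v0 \<notin> g ` (Bf - Ba)" using g v0 B0 by blast
  have "inj_on G C"
  proof -
    have "inj_on G (Bf - Ba)" "G ` (Bf - Ba) = g ` (Bf - Ba)"
      using g(2) Gg inj_on_cong[of "Bf - Ba" G g] image_cong[of "Bf - Ba" "Bf - Ba" G g] by blast+
    then show ?thesis using v0_g Gv vBf by (simp add: C_def)
  qed
  moreover have "independent (G ` C)"
  proof -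
    have "v0 \<notin> span (g ` (Bf - Ba))"
      using span_mono[OF g(1)] span_f0 v0 by blast
    then show ?thesis
      unfolding GC using independent_mono[OF B0(2) g(1)] by (intro independent_insertI)
  qed
  ultimately have inj: "inj_on G (span C)"
    by (intro G.inj_on_span_independent_image)
  have span_b: "span (insert v Bf) = b"
  proof (rule eq_if_height_le)
    show "span (insert v Bf) \<subseteq> b"
      using v Bf incl sub by (intro span_minimal) auto
    show "dim b \<le> dim (span (insert v Bf))"
      using dims \<open>v \<notin> span Bf\<close> dim_span[of Bf] by (simp add: dim_insert span_f)
  qed (use sub in \<open>auto simp: subspaces_def\<close>)
  have span_e: "span (insert v Ba) = e"
  proof (rule eq_if_height_le)
    show "span (insert v Ba) \<subseteq> e"
      using v Ba incl sub by (intro span_minimal) auto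
    have "v \<notin> span Ba" using v incl span_a by blast
    then show "dim e \<le> dim (span (insert v Ba))"
      using dims dim_span[of Ba] by (simp add: dim_insert span_a)
  qed (use sub in \<open>auto simp: subspaces_def\<close>)
  show thesis
  proof (rule that)
    show "Vector_Spaces.linear scale scale G" by (rule G)
    fix u assume "u \<in> b"
    have "insert v Bf = Ba \<union> C" using Bf(1) by (auto simp: C_def)
    then obtain s t where st: "u = s + t" "s \<in> a" "t \<in> span C"
      using \<open>u \<in> b\<close> span_b span_a by (auto simp: span_Un)
    show "G u = 0 \<longleftrightarrow> u \<in> a"
    proof
      assume "G u = 0"
      then have "G t = G 0" using st Ga by (simp add: G.add)
      then have "t = 0" using inj st(3) span_zero by (metis inj_onD)
      then show "u \<in> a" using st by simp
    qed (rule Ga)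
  next
    have "dim (span {v0}) = 1" using v0 sub(6) subspace_0 by auto
    moreover have "span {v0} \<subseteq> e0" using v0 sub by (intro span_minimal) auto
    ultimately have "span {v0} = e0"
      using dims sub by (intro eq_if_height_le) (auto simp: subspaces_def)
    moreover have "span {v0} = G ` span {v}" using G.span_image[of "{v}"] Gv by simp
    moreover have "span {v} \<subseteq> e" using v sub by (intro span_minimal) auto
    ultimately show "e0 \<subseteq> G ` e" by blast
  next
    have "G ` Bf \<subseteq> f0"
    proof
      fix w assume "w \<in> G ` Bf"
      then obtain u where "u \<in> Bf" "w = G u" by blast
      then show "w \<in> f0"
        using Gg[of u] Ga[of u] g(1) B0(1) Ba(1) subspace_0[OF sub(6)] by (cases "u \<in> Ba") auto
    qed
    then show "G ` f \<subseteq> f0"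
      using G.span_image[of Bf] span_minimal[OF _ sub(6)] span_f by metis
  qed
qed

text \<open>
  One splitting of the whole space yields splittings of all intervals along all pairs \<open>(e, f)\<close>: with
  \<open>G\<close> from \<open>linear_collapse_exists\<close>, sort the members \<open>u\<close> of \<open>[a, b]\<close> by the part that contains \<open>G ` u\<close>.
  For \<open>x \<subseteq> G ` b\<close>, the condition \<open>x \<subseteq> G ` u\<close> means that \<open>u\<close> contains the preimage of \<open>x\<close> in \<open>b\<close>, since \<open>u\<close>
  contains the kernel \<open>a\<close> of \<open>G\<close> on \<open>b\<close>; likewise for upper bounds. Hence the preimage of a part is an
  interval or empty. Preimages of atoms in \<open>G ` b\<close> are one step above \<open>a\<close>, and preimages of hyperplanes
  not above \<open>e0\<close> are one step below \<open>b\<close>, since the image of \<open>e\<close> contains \<open>e0\<close>.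
\<close>

lemma splitting_subspaces_transfer:
  assumes Q: "splitting (subspaces scale) dim {0} UNIV e0 f0 Q"
    and L0: "subspace e0" "subspace f0" "dim e0 = 1" "dim f0 + 1 = dim UNIV" "\<not> e0 \<subseteq> f0"
    and ab: "subspace a" "subspace b"
    and e: "e \<in> interval (subspaces scale) a b" "dim e = dim a + 1"
    and f: "f \<in> interval (subspaces scale) a b" "dim f + 1 = dim b" and ef: "\<not> e \<subseteq> f"
  shows "\<exists>Q'. splitting (subspaces scale) dim a b e f Q'"
proof -
  let ?L = "subspaces scale"
  interpret support_lattice ?L dim by (rule support_lattice_subspaces)
  have sub: "subspace e" "subspace f" "a \<subseteq> e" "e \<subseteq> b" "a \<subseteq> f" "f \<subseteq> b"
    using e f by (auto simp: interval_def subspaces_def)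
  obtain G where G: "Vector_Spaces.linear scale scale G"
    and ker: "\<And>u. u \<in> b \<Longrightarrow> G u = 0 \<longleftrightarrow> u \<in> a" and Ge: "e0 \<subseteq> G ` e" and Gf: "G ` f \<subseteq> f0"
    by (rule linear_collapse_exists[OF ab sub(1,2) L0(1,2) sub(3-6) e(2) f(2) L0(3,4) ef L0(5)]) (rule that)
  interpret G: Vector_Spaces.linear scale scale G by (rule G)
  define pull where "pull x = {u \<in> b. G u \<in> x}" for x
  have pull_sub: "subspace (pull x)" if "subspace x" for x
    using subspace_inter[OF ab(2) G.subspace_vimage[OF that]]
    by (simp add: pull_def vimage_def Int_def)
  have a_b: "a \<subseteq> b" using sub by blast
  have Ga: "G u = 0" if "u \<in> a" for u
    using ker[of u] that a_b by blast
  have a_pull: "a \<subseteq> pull x" if "subspace x" for x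
    using a_b subspace_0[OF that] by (auto simp: pull_def Ga)
  \<comment> \<open>\<open>pull\<close> is a lower adjoint of the image map on the subspaces of \<open>b\<close> that contain \<open>a\<close>.\<close>
  have adj: "x \<subseteq> G ` u \<longleftrightarrow> pull x \<subseteq> u"
    if "x \<subseteq> G ` b" "subspace u" "a \<subseteq> u" "u \<subseteq> b" for x u
  proof
    assume x: "x \<subseteq> G ` u"
    show "pull x \<subseteq> u"
    proof
      fix w assume w: "w \<in> pull x"
      then obtain t where t: "t \<in> u" "G w = G t" using x by (auto simp: pull_def)
      have "w - t \<in> b" using w t that(4) ab(2) by (intro subspace_diff) (auto simp: pull_def)
      then have "w - t \<in> u" using ker[of "w - t"] t that(3) by (auto simp: G.diff)
      then show "w \<in> u" using subspace_add[OF that(2) _ t(1), of "w - t"] by simp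
    qed
  next
    assume "pull x \<subseteq> u"
    then show "x \<subseteq> G ` u" using that(1) unfolding pull_def by blast
  qed
  define T where "T I = {u \<in> interval ?L a b. G ` u \<in> I}" for I
  have part: "partition_on (interval ?L {0} UNIV) Q"
    using Q by (simp add: splitting_def)
  have pulled: "partition_on (interval ?L a b) (T ` Q - {{}})"
  proof (rule partition_onI)
    have "\<exists>I\<in>Q. u \<in> T I" if u: "u \<in> interval ?L a b" for u
    proof -
      have "subspace (G ` u)"
        using u by (intro G.subspace_image) (auto simp: interval_def subspaces_def)
      then have "G ` u \<in> interval ?L {0} UNIV"
        using subspace_0 by (auto simp: interval_def subspaces_def)
      then have "G ` u \<in> \<Union>Q" by (simp only: partition_onD1[OF part])
      then show ?thesis using u unfolding T_def by blast
    qed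
    moreover have "T I \<subseteq> interval ?L a b" for I by (auto simp: T_def)
    ultimately have "(\<Union>I\<in>Q. T I) = interval ?L a b" by blast
    moreover have "\<Union> (T ` Q - {{}}) = \<Union> (T ` Q)" by blast
    ultimately show "\<Union> (T ` Q - {{}}) = interval ?L a b" by simp
    show "{} \<notin> T ` Q - {{}}" by simp
    fix p q assume "p \<in> T ` Q - {{}}" "q \<in> T ` Q - {{}}" "p \<noteq> q"
    then obtain I J where IJ: "I \<in> Q" "J \<in> Q" "p = T I" "q = T J" by blast
    then have "I \<inter> J = {}"
      using disjointD[OF partition_onD2[OF part]] \<open>p \<noteq> q\<close> by metis
    then show "disjnt p q" unfolding IJ by (auto simp: disjnt_def T_def)
  qed
  have members: "\<exists>x'\<in>interval ?L a b. \<exists>y'\<in>interval ?L a b. x' \<subseteq> y' \<and> T I = interval ?L x' y' \<and>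
      (x', y') \<noteq> (a, b) \<and> (x' = a \<or> dim x' = dim a + 1 \<and> \<not> x' \<subseteq> f) \<and>
      (y' = b \<or> dim y' + 1 = dim b \<and> \<not> e \<subseteq> y')" if I: "I \<in> Q" "T I \<noteq> {}" for I
  proof -
    obtain x y where xy: "x \<in> interval ?L {0} UNIV" "y \<in> interval ?L {0} UNIV" "x \<subseteq> y"
      "I = interval ?L x y" "(x, y) \<noteq> ({0}, UNIV)"
      "x = {0} \<or> dim x = dim {0} + 1 \<and> \<not> x \<subseteq> f0" "y = UNIV \<or> dim y + 1 = dim UNIV \<and> \<not> e0 \<subseteq> y"
      using bspec[OF conjunct2[OF Q[unfolded splitting_def]] I(1)] by (elim bexE conjE) (rule that)
    have x: "subspace x" and y: "subspace y" using xy by (auto simp: interval_def subspaces_def)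
    \<comment> \<open>A nonempty preimage forces the lower end into the image of \<open>b\<close>, so that \<open>adj\<close> applies.\<close>
    have xb: "x \<subseteq> G ` b" using I(2) by (auto simp: T_def xy(4) interval_def)
    have T_eq: "T I = interval ?L (pull x) (pull y)"
    proof (rule set_eqI)
      fix u
      have "u \<in> T I \<longleftrightarrow> subspace u \<and> a \<subseteq> u \<and> u \<subseteq> b \<and> x \<subseteq> G ` u \<and> G ` u \<subseteq> y"
        using G.subspace_image[of u] by (auto simp: T_def xy(4) interval_def subspaces_def)
      also have "\<dots> \<longleftrightarrow> subspace u \<and> a \<subseteq> u \<and> u \<subseteq> b \<and> pull x \<subseteq> u \<and> u \<subseteq> pull y"
        using adj[OF xb, of u] by (auto simp: pull_def)
      also have "\<dots> \<longleftrightarrow> u \<in> interval ?L (pull x) (pull y)"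
        using a_pull[OF x] by (auto simp: interval_def subspaces_def pull_def)
      finally show "u \<in> T I \<longleftrightarrow> u \<in> interval ?L (pull x) (pull y)" .
    qed
    have pull_x: "pull x = a \<and> x = {0} \<or> dim (pull x) = dim a + 1 \<and> \<not> pull x \<subseteq> f"
    proof (cases "x = {0}")
      case True
      then show ?thesis using ker a_b by (auto simp: pull_def Ga)
    next
      case False
      then have hx: "dim x = 1" "\<not> x \<subseteq> f0" using xy(6) by auto
      have "\<not> pull x \<subseteq> f"
      proof
        assume "pull x \<subseteq> f"
        then have "x \<subseteq> G ` f" using adj[OF xb sub(2,5,6)] by simp
        then show False using Gf hx by blast
      qed
      moreover have "dim (pull x) = dim a + 1"
      proof -
        obtain w0 where w0: "w0 \<in> x" "w0 \<noteq> 0" using False subspace_0[OF x] by blast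
        then obtain w where w: "w \<in> b" "G w = w0" using xb by blast
        have wa: "w \<notin> a" using ker w w0 by blast
        have "span {w0} \<subseteq> x" using w0 x by (intro span_minimal) auto
        then have "span {w0} = x"
          using w0 x hx by (intro eq_if_height_le) (auto simp: subspaces_def)
        have "pull x = span (insert w a)"
        proof
          show "span (insert w a) \<subseteq> pull x"
            using pull_sub[OF x] a_pull[OF x] w w0 by (intro span_minimal) (auto simp: pull_def)
          show "pull x \<subseteq> span (insert w a)"
          proof
            fix u assume u: "u \<in> pull x"
            then have "G u \<in> span {w0}" using \<open>span {w0} = x\<close> by (simp add: pull_def)
            then obtain c where c: "G u = scale c w0" by (auto simp: span_singleton)
            have "u - scale c w \<in> b"
              using u w ab(2) by (intro subspace_diff subspace_scale) (auto simp: pull_def)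
            moreover have "G (u - scale c w) = 0"
              using c w by (simp add: G.diff G.scale)
            ultimately have "u - scale c w \<in> a"
              using ker by blast
            then show "u \<in> span (insert w a)"
              unfolding span_breakdown_eq using span_base by blast
          qed
        qed
        then show ?thesis using wa ab by (simp add: dim_insert span_eq_iff[THEN iffD2])
      qed
      ultimately show ?thesis by blast
    qed
    have pull_y: "pull y = b \<and> y = UNIV \<or> dim (pull y) + 1 = dim b \<and> \<not> e \<subseteq> pull y"
    proof (cases "y = UNIV")
      case True
      then show ?thesis by (auto simp: pull_def)
    next
      case False
      then have hy: "dim y + 1 = dim UNIV" "\<not> e0 \<subseteq> y" using xy(7) by auto
      obtain v0 where v0: "v0 \<in> e0" "v0 \<notin> y" using hy by blast
      then obtain v where v: "v \<in> e" "G v = v0" using Ge by blast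
      have "v \<notin> pull y" using v v0 by (simp add: pull_def)
      have "span (insert v0 y) = UNIV"
        using hy v0 y by (intro dim_eq_full[THEN iffD1]) (simp add: dim_insert dimension_def span_eq_iff[THEN iffD2])
      have "span (insert v (pull y)) = b"
      proof
        show "span (insert v (pull y)) \<subseteq> b"
          using v sub ab by (intro span_minimal) (auto simp: pull_def)
        show "b \<subseteq> span (insert v (pull y))"
        proof
          fix u assume u: "u \<in> b"
          have "G u \<in> span (insert v0 y)" using \<open>span (insert v0 y) = UNIV\<close> by simp
          then obtain c where "G u - scale c v0 \<in> y"
            using y unfolding span_breakdown_eq by (auto simp: span_eq_iff[THEN iffD2])
          then have "G (u - scale c v) \<in> y" using v by (simp add: G.diff G.scale)
          moreover have "u - scale c v \<in> b"
            using u v sub ab(2) by (intro subspace_diff subspace_scale) auto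
          ultimately have "u - scale c v \<in> pull y" by (simp add: pull_def)
          then show "u \<in> span (insert v (pull y))"
            unfolding span_breakdown_eq using span_base by blast
        qed
      qed
      then have "dim b = dim (pull y) + 1"
        using \<open>v \<notin> pull y\<close> pull_sub[OF y] dim_span[of "insert v (pull y)"]
        by (simp add: dim_insert span_eq_iff[THEN iffD2])
      then show ?thesis using \<open>v \<notin> pull y\<close> v by auto
    qed
    have in_ab: "pull x \<in> interval ?L a b" "pull y \<in> interval ?L a b" "pull x \<subseteq> pull y"
      using pull_sub[OF x] pull_sub[OF y] a_pull[OF x] a_pull[OF y] xy(3)
      by (auto simp: interval_def subspaces_def pull_def)
    have ne: "(pull x, pull y) \<noteq> (a, b)"
    proof
      assume "(pull x, pull y) = (a, b)"
      then have "x = {0}" "y = UNIV" using pull_x pull_y by simp_all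
      then show False using xy(5) by simp
    qed
    have pxy: "pull x = a \<or> dim (pull x) = dim a + 1 \<and> \<not> pull x \<subseteq> f"
      "pull y = b \<or> dim (pull y) + 1 = dim b \<and> \<not> e \<subseteq> pull y"
      using pull_x pull_y by argo+
    show ?thesis
      by (intro bexI[of _ "pull x"] bexI[of _ "pull y"] conjI in_ab T_eq ne pxy)
  qed
  have "splitting ?L dim a b e f (T ` Q - {{}})"
    unfolding splitting_def
  proof (intro conjI ballI pulled, elim DiffE imageE)
    fix I J assume "J \<notin> {{}}" "J = T I" "I \<in> Q"
    then show "\<exists>x'\<in>interval ?L a b. \<exists>y'\<in>interval ?L a b. x' \<subseteq> y' \<and> J = interval ?L x' y' \<and>
      (x', y') \<noteq> (a, b) \<and> (x' = a \<or> dim x' = dim a + 1 \<and> \<not> x' \<subseteq> f) \<and>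
      (y' = b \<or> dim y' + 1 = dim b \<and> \<not> e \<subseteq> y')"
      using members[of I] by simp
  qed
  then show ?thesis ..
qed

lemma tutte_partition_subspaces:
  assumes "rank_function (subspaces scale) dim r"
    and "has_proper_interval_decomposition (subspaces scale) dim q"
  shows "\<exists>P. tutte_partition (subspaces scale) dim r P"
proof -
  interpret support_lattice "subspaces scale" dim by (rule support_lattice_subspaces)
  interpret ranked_lattice "subspaces scale" dim r
    using assms(1) by unfold_locales
  obtain e0 f0 Q where *: "e0 \<in> subspaces scale" "f0 \<in> subspaces scale" "dim e0 = 1"
      "dim f0 + 1 = dim UNIV" "\<not> e0 \<subseteq> f0" "splitting (subspaces scale) dim {0} UNIV e0 f0 Q"
    using splitting_if_decomposition[OF assms(2)] unfolding top_elt_subspaces bottom_elt_subspaces by blast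
  show ?thesis
  proof (rule tutte_partition_if_splittings)
    fix a b e f
    assume "a \<in> subspaces scale" "b \<in> subspaces scale" "e \<in> interval (subspaces scale) a b"
      "f \<in> interval (subspaces scale) a b" "dim e = dim a + 1" "dim f + 1 = dim b" "\<not> e \<subseteq> f"
    then show "\<exists>Q. splitting (subspaces scale) dim a b e f Q"
      using * by (intro splitting_subspaces_transfer[of e0 f0 Q]) (auto simp: subspaces_def)
  qed
qed

end

theorem theorem51:
  fixes S :: "'a set"
    and r :: "'a set \<Rightarrow> nat"
    and scale :: "'f::{field,finite} \<Rightarrow> 'v::ab_group_add \<Rightarrow> 'v"
    and B :: "'v set"
    and \<rho> :: "'v set \<Rightarrow> nat"
  shows
    "(matroid S r \<longrightarrow>
      has_proper_interval_decomposition (Pow S) card 1 \<longrightarrow>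
      (\<exists>P. tutte_partition (Pow S) card r P)) \<and>
     (q_matroid scale B \<rho> \<longrightarrow>
      has_proper_interval_decomposition (subspaces scale) (vector_space.dim scale)
        (card (UNIV :: 'f set)) \<longrightarrow>
      (\<exists>P. tutte_partition (subspaces scale) (vector_space.dim scale) \<rho> P))"
proof (intro conjI impI)
  assume M: "matroid S r"
  then interpret support_lattice "Pow S" card
    by (intro support_lattice_Pow) (simp add: matroid_def)
  interpret ranked_lattice "Pow S" card r
    using M by unfold_locales (simp add: matroid_def)
  show "\<exists>P. tutte_partition (Pow S) card r P"
    using M splitting_Pow unfolding matroid_def
    by (intro tutte_partition_if_splittings) blast
next
  assume M: "q_matroid scale B \<rho>"
    and dec: "has_proper_interval_decomposition (subspaces scale) (vector_space.dim scale)
        (card (UNIV :: 'f set))"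
  interpret finite_dimensional_vector_space scale B
    using M by (simp add: q_matroid_def)
  show "\<exists>P. tutte_partition (subspaces scale) (vector_space.dim scale) \<rho> P"
    using M dec by (intro tutte_partition_subspaces) (simp_all add: q_matroid_def)
qed

end
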